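(* Let $\phi:\mathcal{G}\to\mathcal{G}'$ be a surjective strong groupoid homomorphism. Then there exists a strong isomorphism $\overline{\phi}:\mathcal{G}/\mathrm{Ker}(\phi)\to\mathcal{G}'$ such that $\phi=\overline{\phi}\circ j$, where $j:\mathcal{G}\to\mathcal{G}/\mathrm{Ker}(\phi)$, $j(g)=g\,\mathrm{Ker}(\phi)$, is the canonical homomorphism.
   Context: A groupoid is a set $\mathcal{G}$ with a partial binary operation, written by concatenation ($\exists gh$ means that $gh$ is defined). An element $e$ is an identity if $\exists eg$ implies $eg=g$ and $\exists g'e$ implies $g'e=g'$; $\mathcal{G}_0$ is the set of identities. Axioms: (i) $\exists g(hl)$ iff $\exists (gh)l$, and then $g(hl)=(gh)l$; (ii) $\exists g(hl)$ iff $\exists gh$ and $\exists hl$; (iii) for each $g$ there are unique identities $d(g),r(g)$ with $\exists gd(g)$ and $\exists r(g)g$; (iv) for each $g$ there is $g^{-1}$ with $\exists g^{-1}g$, $\exists gg^{-1}$, $d(g)=g^{-1}g$, $r(g)=gg^{-1}$. (Thus $\exists gh$ iff $d(g)=r(h)$.) A homomorphism $\phi:\mathcal{G}\to\mathcal{G}'$ is a map such that $\exists xy$ implies $\exists\phi(x)\phi(y)$ and $\phi(xy)=\phi(x)\phi(y)$. It is strong if, for all $x,y\in\mathcal{G}$, $\exists\phi(x)\phi(y)$ implies $\exists xy$. It is an isomorphism if it is bijective. $\mathrm{Ker}(\phi)=\{g\in\mathcal{G}\mid\phi(g)\in\mathcal{G}'_0\}$; it is a normal subgroupoid of $\mathcal{G}$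 (a nonempty subset closed under inverses and under defined products, containing $\mathcal{G}_0$, and such that $g^{-1}hg\in\mathrm{Ker}(\phi)$ for all $g\in\mathcal{G}$ and $h\in\mathrm{Ker}(\phi)$ with $d(h)=r(h)=r(g)$). For a normal subgroupoid $\mathcal{H}$ of $\mathcal{G}$, write $g\equiv_{\mathcal{H}}l$ iff $\exists l^{-1}g$ and $l^{-1}g\in\mathcal{H}$; the class of $g$ is the left coset $g\mathcal{H}=\{gh\mid h\in\mathcal{H},\ r(h)=d(g)\}$. The quotient groupoid $\mathcal{G}/\mathcal{H}$ is the set of left cosets, with $\exists(g\mathcal{H})(l\mathcal{H})$ iff $\exists gl$, and then $(g\mathcal{H})(l\mathcal{H})=gl\mathcal{H}$. *)

theory Defs
  imports Main
begin

text \<open>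
  A partial binary operation on a set is a function into the option type, with
  \<open>None\<close> for an undefined product. Only its values on \<open>carrier\<close> matter.
\<close>

record 'a pgroupoid =
  carrier :: "'a set"
  pmult :: "'a \<Rightarrow> 'a \<Rightarrow> 'a option"

definition defd :: "'a pgroupoid \<Rightarrow> 'a \<Rightarrow> 'a \<Rightarrow> bool" where
  "defd G g h \<longleftrightarrow> pmult G g h \<noteq> None"

definition identities :: "'a pgroupoid \<Rightarrow> 'a set" where
  "identities G = {e \<in> carrier G. \<forall>g \<in> carrier G.
     (defd G e g \<longrightarrow> pmult G e g = Some g) \<and> (defd G g e \<longrightarrow> pmult G g e = Some g)}"

definition gdom :: "'a pgroupoid \<Rightarrow> 'a \<Rightarrow> 'a" where
  "gdom G g = (THE e. e \<in> identities G \<and> defd G g e)"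

definition grng :: "'a pgroupoid \<Rightarrow> 'a \<Rightarrow> 'a" where
  "grng G g = (THE e. e \<in> identities G \<and> defd G e g)"

definition is_inverse :: "'a pgroupoid \<Rightarrow> 'a \<Rightarrow> 'a \<Rightarrow> bool" where
  "is_inverse G g g' \<longleftrightarrow> g' \<in> carrier G \<and>
     pmult G g' g = Some (gdom G g) \<and> pmult G g g' = Some (grng G g)"

definition ginv :: "'a pgroupoid \<Rightarrow> 'a \<Rightarrow> 'a" where
  "ginv G g = (THE g'. is_inverse G g g')"

text \<open>
  \<open>Option.bind (pmult G h l) (pmult G g)\<close> is the iterated product g(hl), so the
  equation in \<open>assoc\<close> says that g(hl) and (gh)l are both undefined, or both defined
  and equal.
\<close>

locale groupoid =
  fixes G :: "'a pgroupoid"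
  assumes closed: "\<lbrakk>g \<in> carrier G; h \<in> carrier G; pmult G g h = Some k\<rbrakk> \<Longrightarrow> k \<in> carrier G"
    and assoc: "\<lbrakk>g \<in> carrier G; h \<in> carrier G; l \<in> carrier G\<rbrakk> \<Longrightarrow>
      Option.bind (pmult G h l) (pmult G g) = Option.bind (pmult G g h) (\<lambda>k. pmult G k l)"
    and defd_iff: "\<lbrakk>g \<in> carrier G; h \<in> carrier G; l \<in> carrier G\<rbrakk> \<Longrightarrow>
      Option.bind (pmult G h l) (pmult G g) \<noteq> None \<longleftrightarrow> defd G g h \<and> defd G h l"
    and ex1_dom: "g \<in> carrier G \<Longrightarrow> \<exists>!e. e \<in> identities G \<and> defd G g e"
    and ex1_rng: "g \<in> carrier G \<Longrightarrow> \<exists>!e. e \<in> identities G \<and> defd G e g"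
    and ex_inverse: "g \<in> carrier G \<Longrightarrow> \<exists>g'. is_inverse G g g'"

definition homomorphism :: "'a pgroupoid \<Rightarrow> 'b pgroupoid \<Rightarrow> ('a \<Rightarrow> 'b) \<Rightarrow> bool" where
  "homomorphism G G' \<phi> \<longleftrightarrow> groupoid G \<and> groupoid G' \<and> \<phi> ` carrier G \<subseteq> carrier G' \<and>
     (\<forall>x \<in> carrier G. \<forall>y \<in> carrier G. \<forall>z. pmult G x y = Some z \<longrightarrow>
        pmult G' (\<phi> x) (\<phi> y) = Some (\<phi> z))"

definition strong_homomorphism :: "'a pgroupoid \<Rightarrow> 'b pgroupoid \<Rightarrow> ('a \<Rightarrow> 'b) \<Rightarrow> bool" where
  "strong_homomorphism G G' \<phi> \<longleftrightarrow> homomorphism G G' \<phi> \<and>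
     (\<forall>x \<in> carrier G. \<forall>y \<in> carrier G. defd G' (\<phi> x) (\<phi> y) \<longrightarrow> defd G x y)"

definition strong_isomorphism :: "'a pgroupoid \<Rightarrow> 'b pgroupoid \<Rightarrow> ('a \<Rightarrow> 'b) \<Rightarrow> bool" where
  "strong_isomorphism G G' \<phi> \<longleftrightarrow>
     strong_homomorphism G G' \<phi> \<and> bij_betw \<phi> (carrier G) (carrier G')"

definition Ker :: "'a pgroupoid \<Rightarrow> 'b pgroupoid \<Rightarrow> ('a \<Rightarrow> 'b) \<Rightarrow> 'a set" where
  "Ker G G' \<phi> = {g \<in> carrier G. \<phi> g \<in> identities G'}"

definition normal_subgroupoid :: "'a pgroupoid \<Rightarrow> 'a set \<Rightarrow> bool" where
  "normal_subgroupoid G H \<longleftrightarrow> H \<noteq> {} \<and> H \<subseteq> carrier G \<and> identities G \<subseteq> H \<and>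
     (\<forall>h \<in> H. ginv G h \<in> H) \<and>
     (\<forall>h \<in> H. \<forall>k \<in> H. \<forall>l. pmult G h k = Some l \<longrightarrow> l \<in> H) \<and>
     (\<forall>g \<in> carrier G. \<forall>h \<in> H. gdom G h = grng G h \<and> grng G h = grng G g \<longrightarrow>
        (\<exists>k \<in> H. Option.bind (pmult G h g) (pmult G (ginv G g)) = Some k))"

definition left_coset :: "'a pgroupoid \<Rightarrow> 'a set \<Rightarrow> 'a \<Rightarrow> 'a set" where
  "left_coset G H g = {the (pmult G g h) | h. h \<in> H \<and> grng G h = gdom G g}"

definition coset_cong :: "'a pgroupoid \<Rightarrow> 'a set \<Rightarrow> 'a \<Rightarrow> 'a \<Rightarrow> bool" where
  "coset_cong G H g l \<longleftrightarrow> (\<exists>k \<in> H. pmult G (ginv G l) g = Some k)"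

text \<open>
  The product of two cosets is defined through representatives. It does not depend on
  their choice when \<open>H\<close> is the kernel of a strong homomorphism
  (\<open>quotient_Ker_well_defined\<close> below), but it can for an arbitrary normal subgroupoid,
  which may contain elements with different domain and range. The definition therefore
  reads: AB is defined if some representatives are composable, and its value is the
  only coset arising from composable representatives.
\<close>

definition quotient_groupoid :: "'a pgroupoid \<Rightarrow> 'a set \<Rightarrow> 'a set pgroupoid" where
  "quotient_groupoid G H =
    \<lparr>carrier = left_coset G H ` carrier G,
     pmult = (\<lambda>A B.
       if \<exists>g \<in> carrier G. \<exists>l \<in> carrier G. A = left_coset G H g \<and> B = left_coset G H l \<and> defd G g l
       then Some (THE C. \<exists>g \<in> carrier G. \<exists>l \<in> carrier G. \<exists>k.
              A = left_coset G H g \<and> B = left_coset G H l \<and>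
              pmult G g l = Some k \<and> C = left_coset G H k)
       else None)\<rparr>"

context groupoid
begin

lemma gdom: assumes "g \<in> carrier G"
  shows "gdom G g \<in> identities G" "defd G g (gdom G g)"
  using theI'[OF ex1_dom[OF assms]] by (auto simp: gdom_def)

lemma grng: assumes "g \<in> carrier G"
  shows "grng G g \<in> identities G" "defd G (grng G g) g"
  using theI'[OF ex1_rng[OF assms]] by (auto simp: grng_def)

lemma gdom_eqI: "\<lbrakk>g \<in> carrier G; e \<in> identities G; defd G g e\<rbrakk> \<Longrightarrow> gdom G g = e"
  using ex1_dom gdom by blast

lemma grng_eqI: "\<lbrakk>g \<in> carrier G; e \<in> identities G; defd G e g\<rbrakk> \<Longrightarrow> grng G g = e"
  using ex1_rng grng by blast

lemma identity_carrier: "e \<in> identities G \<Longrightarrow> e \<in> carrier G"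
  by (simp add: identities_def)

lemma pmult_gdom: "g \<in> carrier G \<Longrightarrow> pmult G g (gdom G g) = Some g"
  using gdom[of g] by (auto simp: identities_def)

lemma pmult_grng: "g \<in> carrier G \<Longrightarrow> pmult G (grng G g) g = Some g"
  using grng[of g] by (auto simp: identities_def)

lemma defd_iff_gdom_grng:
  assumes g: "g \<in> carrier G" and h: "h \<in> carrier G"
  shows "defd G g h \<longleftrightarrow> gdom G g = grng G h"
proof
  assume d: "defd G g h"
  let ?e = "gdom G g"
  have e: "?e \<in> carrier G" using gdom(1)[OF g] identity_carrier by blast
  have "Option.bind (pmult G ?e h) (pmult G g) \<noteq> None"
    using d assoc[OF g e h] pmult_gdom[OF g] by (simp add: defd_def)
  then show "gdom G g = grng G h"
    using defd_iff[OF g e h] grng_eqI[OF h gdom(1)[OF g]] by simp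
next
  assume eq: "gdom G g = grng G h"
  let ?e = "gdom G g"
  have e: "?e \<in> carrier G" using gdom(1)[OF g] identity_carrier by blast
  show "defd G g h"
    using defd_iff[OF g e h] assoc[OF g e h] pmult_gdom[OF g] gdom(2)[OF g] grng(2)[OF h] eq
    by (simp add: defd_def)
qed

lemma identity_idem:
  assumes "e \<in> identities G"
  shows "gdom G e = e" "grng G e = e" "pmult G e e = Some e"
proof -
  have c: "e \<in> carrier G" using assms identity_carrier by blast
  have f: "gdom G e \<in> carrier G" using gdom(1)[OF c] identity_carrier by blast
  have "pmult G e (gdom G e) = Some (gdom G e)"
    using assms gdom(2)[OF c] f by (auto simp: identities_def)
  then show d: "gdom G e = e" using pmult_gdom[OF c] by simp
  then show "pmult G e e = Some e" using pmult_gdom[OF c] by simp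
  then show "grng G e = e" using grng_eqI[OF c assms] by (simp add: defd_def)
qed

lemma gdom_grng_pmult:
  assumes g: "g \<in> carrier G" and h: "h \<in> carrier G" and k: "pmult G g h = Some k"
  shows "gdom G k = gdom G h" "grng G k = grng G g"
proof -
  have c: "k \<in> carrier G" using closed[OF g h k] .
  have e: "gdom G h \<in> carrier G" "grng G g \<in> carrier G"
    using gdom(1)[OF h] grng(1)[OF g] identity_carrier by blast+
  show "gdom G k = gdom G h"
  proof (rule gdom_eqI[OF c gdom(1)[OF h]])
    have "pmult G k (gdom G h) = pmult G g h"
      using assoc[OF g h e(1)] pmult_gdom[OF h] k by simp
    then show "defd G k (gdom G h)" using k by (simp add: defd_def)
  qed
  show "grng G k = grng G g"
  proof (rule grng_eqI[OF c grng(1)[OF g]])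
    show "defd G (grng G g) k"
      using assoc[OF e(2) g h] pmult_grng[OF g] k by (simp add: defd_def)
  qed
qed

lemma is_inverse_ginv: assumes g: "g \<in> carrier G" shows "is_inverse G g (ginv G g)"
proof -
  have "x = y" if x: "is_inverse G g x" and y: "is_inverse G g y" for x y
  proof -
    have c: "x \<in> carrier G" "y \<in> carrier G" using x y by (auto simp: is_inverse_def)
    have "pmult G x (grng G g) = pmult G (gdom G g) y"
      using assoc[OF c(1) g c(2)] x y by (simp add: is_inverse_def)
    moreover have "pmult G x (grng G g) = Some x"
      using x pmult_gdom[OF c(1)] defd_iff_gdom_grng[OF c(1) g]
      by (simp add: is_inverse_def defd_def)
    moreover have "pmult G (gdom G g) y = Some y"
      using y pmult_grng[OF c(2)] defd_iff_gdom_grng[OF g c(2)]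
      by (simp add: is_inverse_def defd_def)
    ultimately show ?thesis by simp
  qed
  then have "\<exists>!x. is_inverse G g x" using ex_inverse[OF g] by blast
  then show ?thesis unfolding ginv_def by (rule theI')
qed

lemma ginv:
  assumes g: "g \<in> carrier G"
  shows "ginv G g \<in> carrier G" "pmult G (ginv G g) g = Some (gdom G g)"
    "pmult G g (ginv G g) = Some (grng G g)"
    "gdom G (ginv G g) = grng G g" "grng G (ginv G g) = gdom G g"
proof -
  show 1: "ginv G g \<in> carrier G" "pmult G (ginv G g) g = Some (gdom G g)"
    "pmult G g (ginv G g) = Some (grng G g)"
    using is_inverse_ginv[OF g] by (auto simp: is_inverse_def)
  show "gdom G (ginv G g) = grng G g" "grng G (ginv G g) = gdom G g"
    using defd_iff_gdom_grng[OF 1(1) g] defd_iff_gdom_grng[OF g 1(1)] 1(2,3)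
    by (auto simp: defd_def)
qed

lemma pmult_ginv_iff:
  assumes g: "g \<in> carrier G" and h: "h \<in> carrier G" and x: "x \<in> carrier G"
  shows "pmult G g h = Some x \<longleftrightarrow> pmult G (ginv G g) x = Some h"
proof
  assume gh: "pmult G g h = Some x"
  have "gdom G g = grng G h" using gh defd_iff_gdom_grng[OF g h] by (simp add: defd_def)
  then show "pmult G (ginv G g) x = Some h"
    using assoc[OF ginv(1)[OF g] g h] gh ginv(2)[OF g] pmult_grng[OF h] by simp
next
  assume ix: "pmult G (ginv G g) x = Some h"
  have "grng G g = grng G x"
    using ix defd_iff_gdom_grng[OF ginv(1)[OF g] x] ginv(4)[OF g] by (simp add: defd_def)
  then show "pmult G g h = Some x"
    using assoc[OF g ginv(1)[OF g] x] ix ginv(3)[OF g] pmult_grng[OF x] by simp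
qed

lemma mem_left_coset_iff:
  assumes "H \<subseteq> carrier G" and g: "g \<in> carrier G"
  shows "x \<in> left_coset G H g \<longleftrightarrow> (\<exists>h \<in> H. pmult G g h = Some x)"
proof -
  have "grng G h = gdom G g \<longleftrightarrow> pmult G g h \<noteq> None" if "h \<in> H" for h
    using defd_iff_gdom_grng[OF g, of h] assms(1) that by (auto simp: defd_def)
  then show ?thesis by (auto simp: left_coset_def) force
qed

lemma left_coset_eq_class:
  assumes H: "H \<subseteq> carrier G" and g: "g \<in> carrier G"
  shows "left_coset G H g = {l \<in> carrier G. coset_cong G H l g}"
proof (rule set_eqI)
  fix x
  have "(\<exists>h \<in> H. pmult G g h = Some x) \<longleftrightarrow>
      x \<in> carrier G \<and> (\<exists>h \<in> H. pmult G (ginv G g) x = Some h)"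
    using H closed[OF g] pmult_ginv_iff[OF g] by blast
  then show "x \<in> left_coset G H g \<longleftrightarrow> x \<in> {l \<in> carrier G. coset_cong G H l g}"
    using mem_left_coset_iff[OF H g] by (simp add: coset_cong_def)
qed

end

lemma homomorphism_identity:
  assumes "homomorphism G G' \<phi>" and "e \<in> identities G"
  shows "\<phi> e \<in> identities G'"
proof -
  interpret G: groupoid G using assms(1) by (simp add: homomorphism_def)
  interpret G': groupoid G' using assms(1) by (simp add: homomorphism_def)
  have c: "\<phi> e \<in> carrier G'" "e \<in> carrier G"
    using assms G.identity_carrier by (auto simp: homomorphism_def)
  have ee: "pmult G' (\<phi> e) (\<phi> e) = Some (\<phi> e)"
    using assms c G.identity_idem(3) by (simp add: homomorphism_def)
  then have "pmult G' (ginv G' (\<phi> e)) (\<phi> e) = Some (\<phi> e)"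
    using G'.pmult_ginv_iff c by blast
  then show ?thesis using G'.ginv(2)[OF c(1)] G'.gdom(1)[OF c(1)] by simp
qed

lemma homomorphism_ginv:
  assumes "homomorphism G G' \<phi>" and g: "g \<in> carrier G"
  shows "\<phi> (ginv G g) = ginv G' (\<phi> g)"
proof -
  interpret G: groupoid G using assms(1) by (simp add: homomorphism_def)
  interpret G': groupoid G' using assms(1) by (simp add: homomorphism_def)
  have c: "\<phi> g \<in> carrier G'" "\<phi> (ginv G g) \<in> carrier G'" "\<phi> (grng G g) \<in> carrier G'"
    using assms G.ginv(1)[OF g] G.identity_carrier[OF G.grng(1)[OF g]]
    by (auto simp: homomorphism_def)
  have gi: "pmult G' (\<phi> g) (\<phi> (ginv G g)) = Some (\<phi> (grng G g))"
    using assms G.ginv[OF g] by (simp add: homomorphism_def)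
  have "\<phi> (grng G g) \<in> identities G'"
    using homomorphism_identity[OF assms(1)] G.grng(1)[OF g] by blast
  moreover have "grng G' (\<phi> (grng G g)) = grng G' (\<phi> g)"
    using G'.gdom_grng_pmult(2)[OF c(1,2) gi] .
  ultimately have "\<phi> (grng G g) = grng G' (\<phi> g)" using G'.identity_idem(2) by simp
  then have "pmult G' (ginv G' (\<phi> g)) (grng G' (\<phi> g)) = Some (\<phi> (ginv G g))"
    using gi G'.pmult_ginv_iff[OF c] by simp
  then show ?thesis
    using G'.pmult_gdom[OF G'.ginv(1)[OF c(1)]] G'.ginv(4)[OF c(1)] by simp
qed

lemma normal_subgroupoid_Ker:
  assumes hom: "homomorphism G G' \<phi>" and ne: "carrier G \<noteq> {}"
  shows "normal_subgroupoid G (Ker G G' \<phi>)"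
proof -
  interpret G: groupoid G using hom by (simp add: homomorphism_def)
  interpret G': groupoid G' using hom by (simp add: homomorphism_def)
  have mult: "pmult G' (\<phi> x) (\<phi> y) = Some (\<phi> z)"
    if "x \<in> carrier G" "y \<in> carrier G" "pmult G x y = Some z" for x y z
    using hom that by (auto simp: homomorphism_def)
  have car: "\<phi> x \<in> carrier G'" if "x \<in> carrier G" for x
    using hom that by (auto simp: homomorphism_def)
  have ids: "identities G \<subseteq> Ker G G' \<phi>"
    using homomorphism_identity[OF hom] G.identity_carrier by (auto simp: Ker_def)
  have "Ker G G' \<phi> \<noteq> {}" using ne G.gdom(1) ids by blast
  moreover have "ginv G h \<in> Ker G G' \<phi>" if h: "h \<in> Ker G G' \<phi>" for h
  proof -
    have c: "h \<in> carrier G" and i: "\<phi> h \<in> identities G'" using h by (auto simp: Ker_def)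
    have "ginv G' (\<phi> h) = \<phi> h"
      using G'.pmult_ginv_iff[OF car[OF c] car[OF c] car[OF c]] G'.identity_idem[OF i]
        G'.ginv(2)[OF car[OF c]] G'.ginv(4,5)[OF car[OF c]] G'.pmult_gdom[OF G'.ginv(1)[OF car[OF c]]]
      by simp
    then show ?thesis
      using homomorphism_ginv[OF hom c] i G.ginv(1)[OF c] by (simp add: Ker_def)
  qed
  moreover have "l \<in> Ker G G' \<phi>"
    if "h \<in> Ker G G' \<phi>" "k \<in> Ker G G' \<phi>" "pmult G h k = Some l" for h k l
  proof -
    have c: "h \<in> carrier G" "k \<in> carrier G" "\<phi> h \<in> identities G'" "\<phi> k \<in> identities G'"
      using that by (auto simp: Ker_def)
    have "pmult G' (\<phi> h) (\<phi> k) = Some (\<phi> l)" using mult c that by blast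
    then have "\<phi> l = \<phi> k" using c car by (auto simp: identities_def defd_def)
    then show ?thesis using c G.closed[OF c(1,2)] that by (simp add: Ker_def)
  qed
  moreover have "\<exists>k \<in> Ker G G' \<phi>. Option.bind (pmult G h g) (pmult G (ginv G g)) = Some k"
    if g: "g \<in> carrier G" and h: "h \<in> Ker G G' \<phi>"
      and d: "gdom G h = grng G h" "grng G h = grng G g" for g h
  proof -
    have c: "h \<in> carrier G" and i: "\<phi> h \<in> identities G'" using h by (auto simp: Ker_def)
    obtain x where x: "pmult G h g = Some x"
      using d G.defd_iff_gdom_grng[OF c g] by (auto simp: defd_def)
    have xc: "x \<in> carrier G" using G.closed[OF c g x] .
    have "grng G x = grng G g" using G.gdom_grng_pmult(2)[OF c g x] d by simp
    then obtain k where k: "pmult G (ginv G g) x = Some k"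
      using G.defd_iff_gdom_grng[OF G.ginv(1)[OF g] xc] G.ginv(4)[OF g] by (auto simp: defd_def)
    have kc: "k \<in> carrier G" using G.closed[OF G.ginv(1)[OF g] xc k] .
    have "\<phi> x = \<phi> g" using mult[OF c g x] i car[OF g] by (auto simp: identities_def defd_def)
    then have "\<phi> k = gdom G' (\<phi> g)"
      using mult[OF G.ginv(1)[OF g] xc k] homomorphism_ginv[OF hom g] G'.ginv(2)[OF car[OF g]] by simp
    then have "k \<in> Ker G G' \<phi>" using kc G'.gdom(1)[OF car[OF g]] by (simp add: Ker_def)
    then show ?thesis using x k by simp
  qed
  moreover have "Ker G G' \<phi> \<subseteq> carrier G" by (auto simp: Ker_def)
  ultimately show ?thesis unfolding normal_subgroupoid_def using ids by blast
qed

lemma left_coset_Ker_eq_fibre: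
  assumes "strong_homomorphism G G' \<phi>" and g: "g \<in> carrier G"
  shows "left_coset G (Ker G G' \<phi>) g = {x \<in> carrier G. \<phi> x = \<phi> g}"
proof -
  have hom: "homomorphism G G' \<phi>" using assms by (simp add: strong_homomorphism_def)
  interpret G: groupoid G using hom by (simp add: homomorphism_def)
  interpret G': groupoid G' using hom by (simp add: homomorphism_def)
  have mult: "pmult G' (\<phi> x) (\<phi> y) = Some (\<phi> z)"
    if "x \<in> carrier G" "y \<in> carrier G" "pmult G x y = Some z" for x y z
    using hom that by (auto simp: homomorphism_def)
  have car: "\<phi> x \<in> carrier G'" if "x \<in> carrier G" for x
    using hom that by (auto simp: homomorphism_def)
  have K: "Ker G G' \<phi> \<subseteq> carrier G" by (auto simp: Ker_def)
  show ?thesis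
  proof (intro set_eqI iffI)
    fix x assume "x \<in> left_coset G (Ker G G' \<phi>) g"
    then obtain h where h: "h \<in> Ker G G' \<phi>" "pmult G g h = Some x"
      using G.mem_left_coset_iff[OF K g] by blast
    then have c: "h \<in> carrier G" "\<phi> h \<in> identities G'" by (auto simp: Ker_def)
    then have "\<phi> x = \<phi> g"
      using mult[OF g c(1) h(2)] car[OF g] by (auto simp: identities_def defd_def)
    then show "x \<in> {x \<in> carrier G. \<phi> x = \<phi> g}" using G.closed[OF g c(1) h(2)] by simp
  next
    fix x assume "x \<in> {x \<in> carrier G. \<phi> x = \<phi> g}"
    then have x: "x \<in> carrier G" and eq: "\<phi> x = \<phi> g" by auto
    have "pmult G' (\<phi> (ginv G g)) (\<phi> g) = Some (\<phi> (gdom G g))"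
      using mult[OF G.ginv(1)[OF g] g G.ginv(2)[OF g]] .
    then have "defd G' (\<phi> (ginv G g)) (\<phi> x)" using eq by (simp add: defd_def)
    then have "defd G (ginv G g) x"
      using assms(1) x G.ginv(1)[OF g] by (simp add: strong_homomorphism_def)
    then obtain h where h: "pmult G (ginv G g) x = Some h" by (auto simp: defd_def)
    have hc: "h \<in> carrier G" using G.closed[OF G.ginv(1)[OF g] x h] .
    have "\<phi> h = gdom G' (\<phi> g)"
      using mult[OF G.ginv(1)[OF g] x h] homomorphism_ginv[OF hom g] G'.ginv(2)[OF car[OF g]] eq
      by simp
    then have "h \<in> Ker G G' \<phi>" using hc G'.gdom(1)[OF car[OF g]] by (simp add: Ker_def)
    then show "x \<in> left_coset G (Ker G G' \<phi>) g"
      using G.mem_left_coset_iff[OF K g] G.pmult_ginv_iff[OF g hc x] h by blast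
  qed
qed

lemma quotient_Ker_well_defined:
  assumes strong: "strong_homomorphism G G' \<phi>" and g: "g \<in> carrier G" and l: "l \<in> carrier G"
  defines "K \<equiv> Ker G G' \<phi>"
  shows "pmult (quotient_groupoid G K) (left_coset G K g) (left_coset G K l) =
    map_option (left_coset G K) (pmult G g l)"
proof -
  interpret G: groupoid G
    using strong by (simp add: strong_homomorphism_def homomorphism_def)
  have mult: "pmult G' (\<phi> x) (\<phi> y) = Some (\<phi> z)"
    if "x \<in> carrier G" "y \<in> carrier G" "pmult G x y = Some z" for x y z
    using strong that by (auto simp: strong_homomorphism_def homomorphism_def)
  have eq: "left_coset G K x = left_coset G K y \<longleftrightarrow> \<phi> x = \<phi> y"
    if "x \<in> carrier G" "y \<in> carrier G" for x y
    using left_coset_Ker_eq_fibre[OF strong] that unfolding K_def by auto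
  show ?thesis
  proof (cases "pmult G g l")
    case None
    have "\<not> defd G x y"
      if "x \<in> carrier G" "y \<in> carrier G" "\<phi> g = \<phi> x" "\<phi> l = \<phi> y" for x y
    proof
      assume "defd G x y"
      then have "defd G' (\<phi> g) (\<phi> l)" using mult that by (fastforce simp: defd_def)
      then have "defd G g l" using strong g l by (simp add: strong_homomorphism_def)
      then show False using None by (simp add: defd_def)
    qed
    then show ?thesis using None eq g l by (auto simp: quotient_groupoid_def)
  next
    case (Some k)
    have k: "k \<in> carrier G" using G.closed[OF g l Some] .
    let ?P = "\<lambda>C. \<exists>x \<in> carrier G. \<exists>y \<in> carrier G. \<exists>z. left_coset G K g = left_coset G K x \<and>
      left_coset G K l = left_coset G K y \<and> pmult G x y = Some z \<and> C = left_coset G K z"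
    have "(THE C. ?P C) = left_coset G K k"
    proof (rule the_equality)
      show "?P (left_coset G K k)" using g l Some by blast
    next
      fix C assume "?P C"
      then obtain x y z where x: "x \<in> carrier G" "y \<in> carrier G" "pmult G x y = Some z"
        "left_coset G K g = left_coset G K x" "left_coset G K l = left_coset G K y"
        "C = left_coset G K z" by blast
      have "\<phi> z = \<phi> k"
        using mult[OF g l Some] mult[OF x(1-3)] x(4,5) eq[OF g x(1)] eq[OF l x(2)] by simp
      then show "C = left_coset G K k" using x(6) eq[OF G.closed[OF x(1-3)] k] by simp
    qed
    moreover have "defd G g l" using Some by (simp add: defd_def)
    ultimately show ?thesis using g l Some by (auto simp: quotient_groupoid_def)
  qed
qed

end

theory Submission
  imports Defs
begin

text \<open>
  The kernel cosets of a strong homomorphism \<open>\<phi>\<close> are exactly its nonempty fibres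
  (\<open>left_coset_Ker_eq_fibre\<close>), so \<open>\<phi>\<close> factors through the set of cosets and the induced map
  \<open>\<phi>'\<close> is injective; it is onto because \<open>\<phi>\<close> is. Strength makes \<open>\<phi>\<close> reflect definedness as well as
  preserve products, so \<open>\<phi>'\<close> identifies the partial operation on cosets with the operation
  of \<open>G'\<close>.

  That the cosets form a groupoid then needs no computation with representatives. Every
  groupoid axiom speaks only of the carrier and of the partial operation, so it can be
  pulled back from \<open>G'\<close> along the bijection \<open>\<phi>'\<close> (\<open>groupoid_transport\<close>).
\<close>

lemma strong_homomorphism_pmult:
  assumes "strong_homomorphism G G' \<phi>" and "x \<in> carrier G" and "y \<in> carrier G"
  shows "pmult G' (\<phi> x) (\<phi> y) = map_option \<phi> (pmult G x y)"
proof (cases "pmult G x y")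
  case None
  then have "\<not> defd G' (\<phi> x) (\<phi> y)"
    using assms unfolding strong_homomorphism_def defd_def by blast
  then show ?thesis using None by (simp add: defd_def)
next
  case (Some z)
  then show ?thesis using assms by (simp add: strong_homomorphism_def homomorphism_def)
qed

text \<open>
  The bijection matches identities with identities, because the quantifier over
  the carrier in the definition of an identity can be moved across it; hence it commutes
  with \<open>gdom\<close> and \<open>grng\<close>, and inverses in \<open>Q\<close> are the preimages of inverses in \<open>G'\<close>. Equations
  between possibly undefined products are reflected because \<open>map_option f\<close> is injective on
  values in the carrier.
\<close>

lemma groupoid_transport:
  fixes Q :: "'c pgroupoid" and G' :: "'b pgroupoid"
  assumes "groupoid G'" and bij: "bij_betw f (carrier Q) (carrier G')"
    and closed: "\<And>x y z. \<lbrakk>x \<in> carrier Q; y \<in> carrier Q; pmult Q x y = Some z\<rbrakk> \<Longrightarrow> z \<in> carrier Q"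
    and mult: "\<And>x y. \<lbrakk>x \<in> carrier Q; y \<in> carrier Q\<rbrakk> \<Longrightarrow>
      pmult G' (f x) (f y) = map_option f (pmult Q x y)"
  shows "groupoid Q"
proof -
  interpret G': groupoid G' by fact
  have car: "f x \<in> carrier G'" if "x \<in> carrier Q" for x
    using bij that by (auto simp: bij_betw_def)
  have inj: "f x = f y \<longleftrightarrow> x = y" if "x \<in> carrier Q" "y \<in> carrier Q" for x y
    using bij that by (auto simp: bij_betw_def inj_on_def)
  have sur: "\<exists>x \<in> carrier Q. f x = u" if "u \<in> carrier G'" for u
  proof -
    have "u \<in> f ` carrier Q" using bij_betw_imp_surj_on[OF bij] that by simp
    then show ?thesis by (elim imageE) (rule bexI, simp_all)
  qed
  have mult_Some: "pmult Q x y = Some z \<longleftrightarrow> pmult G' (f x) (f y) = Some (f z)"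
    if "x \<in> carrier Q" "y \<in> carrier Q" "z \<in> carrier Q" for x y z
    using mult[of x y] closed[of x y] inj that by auto
  have defd: "defd Q x y \<longleftrightarrow> defd G' (f x) (f y)" if "x \<in> carrier Q" "y \<in> carrier Q" for x y
    using mult[OF that] by (simp add: defd_def)
  have ball: "(\<forall>u \<in> carrier G'. P u) \<longleftrightarrow> (\<forall>x \<in> carrier Q. P (f x))" for P
    using car sur by metis
  have ids: "e \<in> identities Q \<longleftrightarrow> e \<in> carrier Q \<and> f e \<in> identities G'" for e
    by (auto simp: identities_def ball defd mult_Some car)
  have ex1: "\<exists>!e. e \<in> identities Q \<and> P (f e)"
    if unique: "\<exists>!e. e \<in> identities G' \<and> P e" for P
  proof -
    obtain u where u: "u \<in> identities G'" "P u" using unique by blast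
    obtain e where e: "e \<in> carrier Q" "f e = u" using sur G'.identity_carrier u(1) by blast
    show ?thesis
    proof (rule ex1I[of _ e])
      show "e \<in> identities Q \<and> P (f e)" using ids e u by simp
    next
      fix e' assume e': "e' \<in> identities Q \<and> P (f e')"
      then have "f e' = f e" using ids unique u e by blast
      then show "e' = e" using inj ids e(1) e' by blast
    qed
  qed
  have ex1_dom: "\<exists>!e. e \<in> identities Q \<and> defd Q x e" if x: "x \<in> carrier Q" for x
    using ex1[OF G'.ex1_dom[OF car[OF x]]] defd[OF x] ids by (simp cong: conj_cong)
  have ex1_rng: "\<exists>!e. e \<in> identities Q \<and> defd Q e x" if x: "x \<in> carrier Q" for x
    using ex1[OF G'.ex1_rng[OF car[OF x]]] defd[OF _ x] ids by (simp cong: conj_cong)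
  have dom: "gdom Q x \<in> carrier Q" "f (gdom Q x) = gdom G' (f x)" if x: "x \<in> carrier Q" for x
  proof -
    have d: "gdom Q x \<in> identities Q" "defd Q x (gdom Q x)"
      using theI'[OF ex1_dom[OF x]] by (auto simp: gdom_def)
    then show "gdom Q x \<in> carrier Q" using ids by blast
    then show "f (gdom Q x) = gdom G' (f x)"
      using G'.gdom_eqI[OF car[OF x]] d ids defd[OF x] by auto
  qed
  have rng: "grng Q x \<in> carrier Q" "f (grng Q x) = grng G' (f x)" if x: "x \<in> carrier Q" for x
  proof -
    have r: "grng Q x \<in> identities Q" "defd Q (grng Q x) x"
      using theI'[OF ex1_rng[OF x]] by (auto simp: grng_def)
    then show "grng Q x \<in> carrier Q" using ids by blast
    then show "f (grng Q x) = grng G' (f x)"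
      using G'.grng_eqI[OF car[OF x]] r ids defd[OF _ x] by auto
  qed
  have bindR: "map_option f (Option.bind (pmult Q y z) (pmult Q x)) =
      Option.bind (pmult G' (f y) (f z)) (pmult G' (f x))"
    if "x \<in> carrier Q" "y \<in> carrier Q" "z \<in> carrier Q" for x y z
    using that mult closed[OF that(2,3)] by (cases "pmult Q y z") auto
  have bindL: "map_option f (Option.bind (pmult Q x y) (\<lambda>k. pmult Q k z)) =
      Option.bind (pmult G' (f x) (f y)) (\<lambda>k. pmult G' k (f z))"
    if "x \<in> carrier Q" "y \<in> carrier Q" "z \<in> carrier Q" for x y z
    using that mult closed[OF that(1,2)] by (cases "pmult Q x y") auto
  have inj_option: "p = q"
    if "\<And>k. p = Some k \<Longrightarrow> k \<in> carrier Q" "\<And>k. q = Some k \<Longrightarrow> k \<in> carrier Q"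
      "map_option f p = map_option f q" for p q
    using that inj by (cases p; cases q) auto
  show ?thesis
  proof
    fix x y z assume c: "x \<in> carrier Q" "y \<in> carrier Q" "z \<in> carrier Q"
    show "Option.bind (pmult Q y z) (pmult Q x) = Option.bind (pmult Q x y) (\<lambda>k. pmult Q k z)"
    proof (rule inj_option)
      show "k \<in> carrier Q" if k: "Option.bind (pmult Q y z) (pmult Q x) = Some k" for k
      proof -
        obtain u where u: "pmult Q y z = Some u" "pmult Q x u = Some k"
          using k by (auto simp: bind_eq_Some_conv)
        show ?thesis using closed[OF c(1) closed[OF c(2,3) u(1)] u(2)] .
      qed
      show "k \<in> carrier Q" if k: "Option.bind (pmult Q x y) (\<lambda>k. pmult Q k z) = Some k" for k
      proof -
        obtain u where u: "pmult Q x y = Some u" "pmult Q u z = Some k"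
          using k by (auto simp: bind_eq_Some_conv)
        show ?thesis using closed[OF closed[OF c(1,2) u(1)] c(3) u(2)] .
      qed
      show "map_option f (Option.bind (pmult Q y z) (pmult Q x)) =
          map_option f (Option.bind (pmult Q x y) (\<lambda>k. pmult Q k z))"
        using bindR[OF c] bindL[OF c] G'.assoc c car by simp
    qed
    have "Option.bind (pmult Q y z) (pmult Q x) \<noteq> None \<longleftrightarrow>
        Option.bind (pmult G' (f y) (f z)) (pmult G' (f x)) \<noteq> None"
      using bindR[OF c] by (metis option.map_disc_iff)
    then show "Option.bind (pmult Q y z) (pmult Q x) \<noteq> None \<longleftrightarrow> defd Q x y \<and> defd Q y z"
      using G'.defd_iff c car defd by simp
  next
    fix x assume x: "x \<in> carrier Q"
    obtain y where y: "y \<in> carrier Q" "f y = ginv G' (f x)"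
      using sur[OF G'.ginv(1)[OF car[OF x]]] by blast
    have "is_inverse Q x y"
      using x y dom rng G'.ginv(2,3)[OF car[OF x]] by (simp add: is_inverse_def mult_Some)
    then show "\<exists>y. is_inverse Q x y" by blast
  qed (rule closed ex1_dom ex1_rng; assumption)+
qed

theorem theorem3p16:
  fixes G :: "'a pgroupoid" and G' :: "'b pgroupoid" and \<phi> :: "'a \<Rightarrow> 'b"
  assumes "groupoid G" and "groupoid G'"
    and "strong_homomorphism G G' \<phi>"
    and "\<phi> ` carrier G = carrier G'"
  shows "homomorphism G (quotient_groupoid G (Ker G G' \<phi>)) (left_coset G (Ker G G' \<phi>)) \<and>
    (\<exists>\<phi>'. strong_isomorphism (quotient_groupoid G (Ker G G' \<phi>)) G' \<phi>' \<and>
       (\<forall>g \<in> carrier G. \<phi> g = (\<phi>' \<circ> left_coset G (Ker G G' \<phi>)) g))"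
proof -
  interpret G: groupoid G by fact
  define j where "j = left_coset G (Ker G G' \<phi>)"
  define Q where "Q = quotient_groupoid G (Ker G G' \<phi>)"
  \<comment> \<open>\<open>\<phi>\<close> is constant on a coset, so its image of the coset is a singleton.\<close>
  define \<phi>' where "\<phi>' A = the_elem (\<phi> ` A)" for A
  have fibre: "j g = {x \<in> carrier G. \<phi> x = \<phi> g}" if "g \<in> carrier G" for g
    unfolding j_def by (rule left_coset_Ker_eq_fibre[OF assms(3) that])
  have factor: "\<phi>' (j g) = \<phi> g" if g: "g \<in> carrier G" for g
  proof -
    have "\<phi> ` j g = {\<phi> g}" using fibre[OF g] g by auto
    then show ?thesis by (simp add: \<phi>'_def)
  qed
  have carQ: "carrier Q = j ` carrier G" by (simp add: Q_def j_def quotient_groupoid_def)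
  have multQ: "pmult Q (j g) (j l) = map_option j (pmult G g l)"
    if "g \<in> carrier G" "l \<in> carrier G" for g l
    unfolding Q_def j_def by (rule quotient_Ker_well_defined[OF assms(3) that])
  have bij: "bij_betw \<phi>' (carrier Q) (carrier G')"
    unfolding bij_betw_def inj_on_def carQ using factor fibre assms(4)[symmetric]
    by (auto simp: image_image)
  have closedQ: "C \<in> carrier Q"
    if "A \<in> carrier Q" "B \<in> carrier Q" "pmult Q A B = Some C" for A B C
  proof -
    obtain g l where gl: "g \<in> carrier G" "l \<in> carrier G" "A = j g" "B = j l"
      using \<open>A \<in> carrier Q\<close> \<open>B \<in> carrier Q\<close> carQ by auto
    then obtain k where "pmult G g l = Some k" "C = j k"
      using \<open>pmult Q A B = Some C\<close> multQ by auto
    then show ?thesis using G.closed gl(1,2) carQ by blast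
  qed
  have mult: "pmult G' (\<phi>' A) (\<phi>' B) = map_option \<phi>' (pmult Q A B)"
    if "A \<in> carrier Q" "B \<in> carrier Q" for A B
  proof -
    obtain g l where gl: "g \<in> carrier G" "l \<in> carrier G" "A = j g" "B = j l"
      using \<open>A \<in> carrier Q\<close> \<open>B \<in> carrier Q\<close> carQ by auto
    have "map_option \<phi>' (map_option j (pmult G g l)) = map_option \<phi> (pmult G g l)"
      using G.closed[OF gl(1,2)] factor by (cases "pmult G g l") auto
    then show ?thesis
      using strong_homomorphism_pmult[OF assms(3) gl(1,2)] gl multQ factor by simp
  qed
  have Q: "groupoid Q" using groupoid_transport[OF assms(2) bij closedQ mult] .
  have "homomorphism G Q j"
    using assms(1) Q multQ by (auto simp: homomorphism_def carQ)
  moreover have "strong_isomorphism Q G' \<phi>'"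
    using Q assms(2) mult bij
    by (auto simp: strong_isomorphism_def strong_homomorphism_def homomorphism_def defd_def
        bij_betw_def)
  moreover have "\<forall>g \<in> carrier G. \<phi> g = (\<phi>' \<circ> j) g" using factor by simp
  ultimately show ?thesis unfolding Q_def j_def by blast
qed

end
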